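(* Let $(Y,T)$ be the subshift and $\Psi^1$ the flow on the compact metric space $Y^1$ (suspension of $T|_{Y\setminus\{0\}}$ with constant roof function $1$, compactified by one fixed point $y_\infty$) constructed in the context. Then the flow $\Psi^1$ has only one invariant ergodic Borel probability measure, and this measure is supported on the fixed point $y_\infty$.
   Context: Construction of $(Y,T)$. $\Sigma(2)=\{0,1\}^{\mathbb Z}$ has the product topology and $T$ is the shift $(x_i)\mapsto(x_{i+1})$. For a finite $0$-$1$ word $A$, $|A|$ is its length; $AB$ denotes concatenation; $O(n)$ is the word of $n$ zeros. Finite words $A_n$, $P(n)$ ($|P(n)|=n$) and $Q_n$, $n\ge1$, are defined recursively. Consider the infinite matrix whose entry in row $r\ge1$ and column $c\ge1$ is $P(r)\,O(r^2-1+c)\,P(r)$; enumerate its entries as $Q_1,Q_2,\dots$ along antidiagonals from top to bottom, i.e. the entry $(r,c)$ is $Q_i$ with $i=\frac{(r+c-2)(r+c-1)}{2}+r$ (so first row: $Q_1,Q_2,Q_4,Q_7,\dots$; second row: $Q_3,Q_5,Q_8,\dots$; third row: $Q_6,Q_9,\dots$). Put $A_1=(1)$, $P(1)=A_1$, and for $n\ge2$ put $A_n=A_{n-1}\,O(|A_{n-1}|^2)\,Q_{n-1}$, and let $P(n)$ be the word formed by the first $n$ symbols of $A_n$ (one has $|A_n|\ge n$; $Q_n$ only involves some $P(j)$ with $j\le n$). Since $A_{n-1}$ is a prefix of $A_n$, the limit $y=\lim_{n\to\infty}(A_n000\cdots)$ exists; it is regarded as an element of $\Sigma(2)$ by setting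 $y(i)=0$ at negative positions. Let $Y=\omega(y,T)$ be the $\omega$-limit set of $y$ under $T$ (it does not depend on the values of $y$ at negative positions), a compact $T$-invariant set on which $T$ is a homeomorphism. Its unique fixed point is the all-zeros sequence, denoted $0$; put $Y_*=Y\setminus\{0\}$. Suspension flow. Let $Y_*^1$ be the quotient of $\{(z,u):z\in Y_*,\ 0\le u\le1\}$ by $(z,1)\sim(Tz,0)$, with the suspension flow determined by $\psi^1_t(z,u)=(z,u+t)$ for $-u\le t<1-u$. Let $Y^1=Y_*^1\cup\{y_\infty\}$ be the one-point compactification, a compact metric space in which $(z_n,u_n)\to y_\infty$ if and only if $z_n\to0$ in $Y$. $\Psi^1$ is the flow on $Y^1$ extending $\psi^1$ by $\Psi^1_t(y_\infty)=y_\infty$ for all $t\in\mathbb R$. *)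

theory Defs
  imports "HOL-Probability.Probability" "HOL-Library.Nat_Bijection"
begin

section \<open>The two-sided full shift on two symbols\<close>

text \<open>The symbol 1 is represented by \<^const>\<open>True\<close> and the symbol 0 by \<^const>\<open>False\<close>.  The type
  \<open>int \<Rightarrow> bool\<close> carries the product topology of the discrete topology on \<^typ>\<open>bool\<close>.\<close>

type_synonym sigma2 = "int \<Rightarrow> bool"

definition shift_by :: "int \<Rightarrow> sigma2 \<Rightarrow> sigma2" where
  "shift_by n x = (\<lambda>i. x (i + n))"

definition shift_map :: "sigma2 \<Rightarrow> sigma2" where
  "shift_map = shift_by 1"

definition zero_seq :: sigma2 where
  "zero_seq = (\<lambda>_. False)"

lemma shift_map_apply: "shift_map x i = x (i + 1)"
  by (simp add: shift_map_def shift_by_def)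

lemma shift_by_0 [simp]: "shift_by 0 x = x"
  by (simp add: shift_by_def)

lemma shift_by_shift_by [simp]: "shift_by m (shift_by n x) = shift_by (m + n) x"
  by (simp add: shift_by_def algebra_simps)

lemma shift_map_funpow: "(shift_map ^^ n) x = shift_by (int n) x"
  by (induction n) (simp_all add: shift_map_def algebra_simps)

section \<open>The words \<open>A_word n\<close>, \<open>P_word n\<close>, \<open>Q_word n\<close>\<close>

abbreviation O_word :: "nat \<Rightarrow> bool list" where
  "O_word n \<equiv> replicate n False"

text \<open>Row \<open>r = Suc a\<close> and column \<open>c = Suc b\<close> is the entry number
  \<open>(r + c - 2) * (r + c - 1) div 2 + r = Suc (prod_encode (a, b))\<close>, so position \<open>Suc k\<close> of the
  enumeration is read off from \<open>prod_decode k\<close>; see \<open>Q_entry\<close> below.  The values of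
  \<open>A_word\<close>, \<open>P_word\<close> and \<open>Q_word\<close> at 0 are dummies.\<close>

lemma fst_prod_decode_le: "(a, b) = prod_decode k \<Longrightarrow> a \<le> k"
  by (metis le_prod_encode_1 prod_decode_inverse)

function A_word :: "nat \<Rightarrow> bool list" and P_word :: "nat \<Rightarrow> bool list" and Q_word :: "nat \<Rightarrow> bool list" where
  "A_word 0 = []"
| "A_word (Suc 0) = [True]"
| "A_word (Suc (Suc n)) = A_word (Suc n) @ O_word ((length (A_word (Suc n)))\<^sup>2) @ Q_word (Suc n)"
| "P_word n = take n (A_word n)"
| "Q_word 0 = []"
| "Q_word (Suc k) = (case prod_decode k of (a, b) \<Rightarrow>
      P_word (Suc a) @ O_word ((Suc a)\<^sup>2 - 1 + Suc b) @ P_word (Suc a))"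
  by pat_completeness auto
termination
  by (relation "Wellfounded.measure (\<lambda>s. case s of Inl n \<Rightarrow> 3 * n | Inr (Inl n) \<Rightarrow> 3 * n + 1
                                     | Inr (Inr n) \<Rightarrow> 3 * n + 2)")
     (auto dest: fst_prod_decode_le)

lemma P_1: "P_word 1 = A_word 1"
  by simp

lemma A_rec:
  assumes "n \<ge> 2"
  shows "A_word n = A_word (n - 1) @ O_word ((length (A_word (n - 1)))\<^sup>2) @ Q_word (n - 1)"
proof -
  obtain m where "n = Suc (Suc m)"
    using assms by (metis add_2_eq_Suc le_Suc_ex)
  then show ?thesis
    by (simp del: Q_word.simps)
qed

lemma Q_entry:
  assumes "r \<ge> 1" "c \<ge> 1"
  shows "Q_word ((r + c - 2) * (r + c - 1) div 2 + r) = P_word r @ O_word (r\<^sup>2 - 1 + c) @ P_word r"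
proof -
  obtain a b where ab: "r = Suc a" "c = Suc b"
    using assms by (metis One_nat_def Suc_le_D)
  have "(r + c - 2) * (r + c - 1) div 2 + r = Suc (prod_encode (a, b))"
    by (simp add: ab prod_encode_def triangle_def)
  then show ?thesis
    by (simp add: ab del: P_word.simps)
qed

lemma length_A: "n \<le> length (A_word n)"
proof (induction n rule: induct_nat_012)
  case (ge2 n)
  have "A_word (Suc n) \<noteq> []"
    using ge2 by auto
  then have "(length (A_word (Suc n)))\<^sup>2 \<ge> 1"
    by (simp add: Suc_leI)
  then show ?case
    using ge2 unfolding A_word.simps length_append length_replicate by linarith
qed auto

lemma A_prefix: "1 \<le> m \<Longrightarrow> m \<le> n \<Longrightarrow> \<exists>w. A_word n = A_word m @ w"
proof (induction n rule: nat_induct)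
  case (Suc n)
  show ?case
  proof (cases "m = Suc n")
    case False
    then obtain w where "A_word n = A_word m @ w"
      using Suc by auto
    moreover have "A_word (Suc n) = A_word n @ O_word ((length (A_word n))\<^sup>2) @ Q_word n"
      using A_rec[of "Suc n"] Suc.prems False by simp
    ultimately show ?thesis
      by simp
  qed simp
qed simp

section \<open>The subshift \<open>(Y, T)\<close>\<close>

definition pad :: "bool list \<Rightarrow> sigma2" where
  "pad w = (\<lambda>i. 0 \<le> i \<and> nat i < length w \<and> w ! nat i)"

text \<open>The limit is taken coordinatewise, i.e. in the product topology; see \<open>y_limit\<close>.\<close>

definition y_seq :: sigma2 where
  "y_seq = (\<lambda>i. lim (\<lambda>n. pad (A_word n) i))"

definition omega_limit :: "('a::topological_space \<Rightarrow> 'a) \<Rightarrow> 'a \<Rightarrow> 'a set" where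
  "omega_limit f x = {z. \<exists>k :: nat \<Rightarrow> nat. strict_mono k \<and> (\<lambda>n. (f ^^ k n) x) \<longlonglongrightarrow> z}"

definition Y :: "sigma2 set" where
  "Y = omega_limit shift_map y_seq"

definition Y_star :: "sigma2 set" where
  "Y_star = Y - {zero_seq}"

lemma tendsto_sigma2: "(f \<longlongrightarrow> (x :: sigma2)) F \<longleftrightarrow> (\<forall>i. ((\<lambda>n. f n i) \<longlongrightarrow> x i) F)"
  using limitin_componentwise[of "\<lambda>_::int. euclidean :: bool topology" UNIV f x F]
  by (simp add: euclidean_product_topology)

lemma pad_A_eq: "1 \<le> m \<Longrightarrow> m \<le> n \<Longrightarrow> nat i < m \<Longrightarrow> pad (A_word n) i = pad (A_word m) i"
  using A_prefix[of m n] length_A[of m] length_A[of n]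
  by (auto simp: pad_def nth_append)

lemma pad_A_tendsto: "(\<lambda>n. pad (A_word n) i) \<longlonglongrightarrow> pad (A_word (Suc (nat i))) i"
  by (rule tendsto_eventually, rule eventually_sequentiallyI[of "Suc (nat i)"])
     (rule pad_A_eq, simp_all)

lemma y_eq: "y_seq i = pad (A_word (Suc (nat i))) i"
  unfolding y_seq_def by (rule limI, rule pad_A_tendsto)

lemma y_limit: "(\<lambda>n. pad (A_word n)) \<longlonglongrightarrow> y_seq"
  unfolding tendsto_sigma2 y_eq by (intro allI pad_A_tendsto)

lemma y_negative: "i < 0 \<Longrightarrow> y_seq i = False"
  by (simp add: y_eq pad_def)

lemma y_nonnegative:
  assumes "i < n"
  shows "y_seq (int i) = A_word n ! i"
proof -
  have "y_seq (int i) = pad (A_word n) (int i)"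
    unfolding y_eq using assms by (intro pad_A_eq[symmetric]) auto
  then show ?thesis
    using assms length_A[of n] by (simp add: pad_def)
qed

lemma shift_by_in_Y:
  assumes "x \<in> Y"
  shows "shift_by m x \<in> Y"
proof -
  obtain k where k: "strict_mono k" "\<And>i. (\<lambda>n. shift_by (int (k n)) y_seq i) \<longlonglongrightarrow> x i"
    using assms by (auto simp: Y_def omega_limit_def shift_map_funpow tendsto_sigma2)
  define l where "l n = nat (int (k (n + nat \<bar>m\<bar>)) + m)" for n
  have k_ge: "int n \<le> int (k n)" for n
    using seq_suble[OF k(1)] by simp
  have int_l: "int (l n) = int (k (n + nat \<bar>m\<bar>)) + m" for n
    using k_ge[of "n + nat \<bar>m\<bar>"] by (simp add: l_def)
  have "strict_mono l"
  proof (rule strict_monoI)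
    fix a b :: nat
    assume "a < b"
    then have "int (k (a + nat \<bar>m\<bar>)) < int (k (b + nat \<bar>m\<bar>))"
      using k(1) by (simp add: strict_mono_less)
    then have "int (l a) < int (l b)"
      using int_l[of a] int_l[of b] by linarith
    then show "l a < l b"
      by simp
  qed
  moreover have "(\<lambda>n. shift_by (int (l n)) y_seq i) \<longlonglongrightarrow> shift_by m x i" for i
    using LIMSEQ_ignore_initial_segment[OF k(2)[of "i + m"], of "nat \<bar>m\<bar>"]
    by (simp add: int_l shift_by_def algebra_simps)
  ultimately show ?thesis
    by (auto simp: Y_def omega_limit_def shift_map_funpow tendsto_sigma2)
qed

lemma shift_by_in_Y_star:
  assumes "x \<in> Y_star"
  shows "shift_by m x \<in> Y_star"
proof -
  have "x = zero_seq" if "shift_by m x = zero_seq"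
  proof
    fix i
    show "x i = zero_seq i"
      using fun_cong[OF that, of "i - m"] by (simp add: shift_by_def zero_seq_def)
  qed
  then show ?thesis
    using assms shift_by_in_Y by (auto simp: Y_star_def)
qed

section \<open>The suspension and its one-point compactification\<close>

definition quotient_topology :: "'a topology \<Rightarrow> ('a \<Rightarrow> 'b) \<Rightarrow> 'b topology" where
  "quotient_topology X q =
     topology (\<lambda>U. U \<subseteq> q ` topspace X \<and> openin X {x \<in> topspace X. q x \<in> U})"

lemma openin_quotient_topology:
  "openin (quotient_topology X q) U \<longleftrightarrow>
     U \<subseteq> q ` topspace X \<and> openin X {x \<in> topspace X. q x \<in> U}"
proof -
  have "istopology (\<lambda>U. U \<subseteq> q ` topspace X \<and> openin X {x \<in> topspace X. q x \<in> U})"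
    unfolding istopology_def
  proof (intro conjI allI impI)
    fix S U
    assume *: "S \<subseteq> q ` topspace X \<and> openin X {x \<in> topspace X. q x \<in> S}"
      "U \<subseteq> q ` topspace X \<and> openin X {x \<in> topspace X. q x \<in> U}"
    have "{x \<in> topspace X. q x \<in> S \<inter> U} = {x \<in> topspace X. q x \<in> S} \<inter> {x \<in> topspace X. q x \<in> U}"
      by auto
    with * show "openin X {x \<in> topspace X. q x \<in> S \<inter> U}"
      by (simp only: openin_Int)
    from * show "S \<inter> U \<subseteq> q ` topspace X"
      by blast
  next
    fix K
    assume *: "\<forall>S\<in>K. S \<subseteq> q ` topspace X \<and> openin X {x \<in> topspace X. q x \<in> S}"
    have "{x \<in> topspace X. q x \<in> \<Union>K} = (\<Union>S\<in>K. {x \<in> topspace X. q x \<in> S})"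
      by auto
    with * show "openin X {x \<in> topspace X. q x \<in> \<Union>K}"
      by (simp only: openin_Union ball_simps) auto
    from * show "\<Union>K \<subseteq> q ` topspace X"
      by blast
  qed
  then show ?thesis
    by (simp add: quotient_topology_def topology_inverse')
qed

lemma topspace_quotient_topology [simp]: "topspace (quotient_topology X q) = q ` topspace X"
proof
  have "{x \<in> topspace X. q x \<in> q ` topspace X} = topspace X"
    by auto
  then show "q ` topspace X \<subseteq> topspace (quotient_topology X q)"
    by (intro openin_subset) (simp add: openin_quotient_topology)
  show "topspace (quotient_topology X q) \<subseteq> q ` topspace X"
    using openin_topspace[of "quotient_topology X q"] by (simp only: openin_quotient_topology)
qed

lemma quotient_map_quotient_topology: "quotient_map X (quotient_topology X q) q"
  by (auto simp: quotient_map_def openin_quotient_topology)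

definition susp_dom :: "(sigma2 \<times> real) set" where
  "susp_dom = Y_star \<times> {0..1}"

definition glue :: "(sigma2 \<times> real) rel" where
  "glue = {((z, 1), (shift_map z, 0)) | z. z \<in> Y_star}"

definition susp_rel :: "(sigma2 \<times> real) rel" where
  "susp_rel = (glue \<union> glue\<inverse>)\<^sup>* \<inter> susp_dom \<times> susp_dom"

definition susp_class :: "sigma2 \<times> real \<Rightarrow> (sigma2 \<times> real) set" where
  "susp_class p = susp_rel `` {p}"

definition suspension :: "(sigma2 \<times> real) set topology" where
  "suspension = quotient_topology (top_of_set susp_dom) susp_class"

type_synonym Y1_point = "(sigma2 \<times> real) set option"

definition Y1 :: "Y1_point topology" where
  "Y1 = Alexandroff_compactification suspension"

definition y_inf :: Y1_point where
  "y_inf = None"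

section \<open>The flow \<open>\<Psi>\<^sup>1\<close>\<close>

text \<open>Iterating \<open>(z, u) \<mapsto> (z, u + t)\<close> and \<open>(z, 1) \<sim> (shift_map z, 0)\<close> moves \<open>(z, u)\<close> in time \<open>t\<close> to
  \<open>(shift_by n z, u + t - n)\<close> with \<open>n = \<lfloor>u + t\<rfloor>\<close>.  The image set in \<open>psi1\<close> is a singleton for
  every class in the suspension.\<close>

definition move :: "real \<Rightarrow> sigma2 \<times> real \<Rightarrow> sigma2 \<times> real" where
  "move t = (\<lambda>(z, u). (shift_by \<lfloor>u + t\<rfloor> z, frac (u + t)))"

definition psi1 :: "real \<Rightarrow> (sigma2 \<times> real) set \<Rightarrow> (sigma2 \<times> real) set" where
  "psi1 t C = the_elem ((susp_class \<circ> move t) ` C)"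

definition Psi1 :: "real \<Rightarrow> Y1_point \<Rightarrow> Y1_point" where
  "Psi1 t = map_option (psi1 t)"

lemma equiv_susp_rel: "equiv susp_dom susp_rel"
proof (rule equivI)
  have sym: "sym ((glue \<union> glue\<inverse>)\<^sup>*)"
    by (intro sym_rtrancl sym_Un_converse)
  show "sym susp_rel"
    using sym unfolding susp_rel_def sym_def by blast
  show "trans susp_rel"
    unfolding susp_rel_def trans_def by (blast intro: rtrancl_trans)
qed (auto simp: susp_rel_def refl_on_def)

lemma move_eq_if_susp_rel:
  assumes "(p, q) \<in> susp_rel"
  shows "move t p = move t q"
proof -
  have "(p, q) \<in> (glue \<union> glue\<inverse>)\<^sup>*"
    using assms by (simp add: susp_rel_def)
  then show ?thesis
  proof (induction rule: rtrancl_induct)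
    case (step q r)
    have "move t (z, 1) = move t (shift_map z, 0)" for z
      by (simp add: move_def shift_map_def frac_def add.commute[of 1])
    then have "move t q = move t r"
      using step.hyps(2) by (auto simp: glue_def)
    with step show ?case
      by simp
  qed simp
qed

lemma move_in_susp_dom: "p \<in> susp_dom \<Longrightarrow> move t p \<in> susp_dom"
  by (auto simp: susp_dom_def move_def shift_by_in_Y_star frac_lt_1 less_imp_le)

lemma susp_class_glue:
  assumes "z \<in> Y_star"
  shows "susp_class (z, 1) = susp_class (shift_map z, 0)"
proof -
  have "((z, 1), (shift_map z, 0)) \<in> susp_rel"
    using assms shift_by_in_Y_star[OF assms, of 1]
    by (auto simp: susp_rel_def susp_dom_def glue_def shift_map_def)
  then show ?thesis
    unfolding susp_class_def by (rule equiv_class_eq[OF equiv_susp_rel])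
qed

lemma psi1_susp_class:
  assumes "p \<in> susp_dom"
  shows "psi1 t (susp_class p) = susp_class (move t p)"
proof -
  have "(p, p) \<in> susp_rel"
    using assms by (simp add: susp_rel_def)
  then have "p \<in> susp_class p"
    by (simp add: susp_class_def)
  moreover have "(susp_class \<circ> move t) q = susp_class (move t p)" if "q \<in> susp_class p" for q
    using that move_eq_if_susp_rel[of p q t] by (simp add: susp_class_def)
  ultimately have "(susp_class \<circ> move t) ` susp_class p = {susp_class (move t p)}"
    by (intro equalityI subsetI) (auto simp del: comp_apply)
  then show ?thesis
    by (simp add: psi1_def)
qed

lemma topspace_suspension: "topspace suspension = susp_class ` susp_dom"
  by (simp add: suspension_def)

lemma topspace_Y1: "topspace Y1 = insert y_inf (Some ` susp_class ` susp_dom)"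
  by (simp add: Y1_def y_inf_def topspace_suspension)

text \<open>The formula determining the suspension flow.\<close>

lemma Psi1_local:
  assumes "z \<in> Y_star" "0 \<le> u" "u \<le> 1" "- u \<le> t" "t < 1 - u"
  shows "Psi1 t (Some (susp_class (z, u))) = Some (susp_class (z, u + t))"
proof -
  have "\<lfloor>u + t\<rfloor> = 0"
    using assms by linarith
  then show ?thesis
    using assms by (simp add: Psi1_def psi1_susp_class susp_dom_def move_def frac_def)
qed

lemma Psi1_y_inf: "Psi1 t y_inf = y_inf"
  by (simp add: Psi1_def y_inf_def)

lemma Psi1_susp_class:
  "p \<in> susp_dom \<Longrightarrow> Psi1 t (Some (susp_class p)) = Some (susp_class (move t p))"
  by (simp add: Psi1_def psi1_susp_class)

lemma Y1_cases:
  assumes "x \<in> topspace Y1"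
  obtains "x = y_inf" | z u where "(z, u) \<in> susp_dom" "x = Some (susp_class (z, u))"
  using assms unfolding topspace_Y1 by auto

lemma Psi1_in_Y1:
  assumes "x \<in> topspace Y1"
  shows "Psi1 t x \<in> topspace Y1"
  using assms
proof (cases rule: Y1_cases)
  case (2 z u)
  then show ?thesis
    using move_in_susp_dom[OF 2(1)] unfolding topspace_Y1 by (simp add: Psi1_susp_class)
qed (simp add: Psi1_y_inf topspace_Y1)

lemma Psi1_0:
  assumes "x \<in> topspace Y1"
  shows "Psi1 0 x = x"
proof -
  have "susp_class (move 0 (z, u)) = susp_class (z, u)" if "(z, u) \<in> susp_dom" for z u
  proof (cases "u = 1")
    case True
    then show ?thesis
      using susp_class_glue[of z] that by (simp add: move_def susp_dom_def shift_map_def)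
  next
    case False
    then have "\<lfloor>u\<rfloor> = 0"
      using that unfolding susp_dom_def by (auto simp: floor_eq_iff)
    then show ?thesis
      by (simp add: move_def frac_def)
  qed
  then show ?thesis
    using assms by (elim Y1_cases) (simp_all add: Psi1_y_inf Psi1_susp_class)
qed

lemma Psi1_add:
  assumes "x \<in> topspace Y1"
  shows "Psi1 (s + t) x = Psi1 s (Psi1 t x)"
proof -
  have "move (s + t) p = move s (move t p)" for p
  proof -
    obtain z u where p: "p = (z, u)"
      by (cases p)
    have "u + (s + t) = (frac (u + t) + s) + of_int \<lfloor>u + t\<rfloor>"
      by (simp add: frac_def)
    moreover have "\<lfloor>v + of_int n\<rfloor> = \<lfloor>v\<rfloor> + n" "frac (v + of_int n) = frac v" for v :: real and n
      by (simp_all add: frac_def)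
    ultimately show ?thesis
      unfolding p move_def prod.case by (simp only: shift_by_shift_by)
  qed
  then show ?thesis
    using assms by (elim Y1_cases) (simp_all add: Psi1_y_inf Psi1_susp_class move_in_susp_dom)
qed

section \<open>Invariant ergodic Borel probability measures of a flow\<close>

definition borel_prob_on :: "'a topology \<Rightarrow> 'a measure \<Rightarrow> bool" where
  "borel_prob_on X \<mu> \<longleftrightarrow>
     space \<mu> = topspace X \<and> sets \<mu> = sigma_sets (topspace X) {U. openin X U} \<and> prob_space \<mu>"

definition flow_invariant :: "(real \<Rightarrow> 'a \<Rightarrow> 'a) \<Rightarrow> 'a measure \<Rightarrow> bool" where
  "flow_invariant \<Phi> \<mu> \<longleftrightarrow>
     (\<forall>t. \<Phi> t \<in> measurable \<mu> \<mu> \<and>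
          (\<forall>B \<in> sets \<mu>. emeasure \<mu> (\<Phi> t -` B \<inter> space \<mu>) = emeasure \<mu> B))"

definition flow_ergodic :: "(real \<Rightarrow> 'a \<Rightarrow> 'a) \<Rightarrow> 'a measure \<Rightarrow> bool" where
  "flow_ergodic \<Phi> \<mu> \<longleftrightarrow>
     (\<forall>B \<in> sets \<mu>. (\<forall>t. \<Phi> t -` B \<inter> space \<mu> = B) \<longrightarrow> emeasure \<mu> B = 0 \<or> emeasure \<mu> B = 1)"

definition invariant_ergodic_measure ::
    "'a topology \<Rightarrow> (real \<Rightarrow> 'a \<Rightarrow> 'a) \<Rightarrow> 'a measure \<Rightarrow> bool" where
  "invariant_ergodic_measure X \<Phi> \<mu> \<longleftrightarrow>
     borel_prob_on X \<mu> \<and> flow_invariant \<Phi> \<mu> \<and> flow_ergodic \<Phi> \<mu>"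

end

(* In every word A_n a window of length N contains at most 3 sqrt N ones: a window longer than the
   gap L^2 after a block of length L has room for all ones seen so far, and a shorter one meets only
   one of the two blocks around the gap; the same dichotomy applies to the two copies of P(r) in
   Q_n, whose distance is at least r^2. The bound passes to y and to all of Y. Let V be the open set
   of classes [z, u] with z(0) = 1 and 0 < u < 1. Its visits along an orbit have uniform density
   zero, so an invariant measure gives V measure 0. As the preimages of V under the times m/2 cover
   everything except the point at infinity, the measure is the point mass there. *)

theory Submission
  imports Defs "HOL-Real_Asymp.Real_Asymp"
begin

declare A_word.simps [simp del] P_word.simps [simp del] Q_word.simps [simp del]

section \<open>Windows of points of \<open>Y\<close> contain few ones\<close>

definition window :: "sigma2 \<Rightarrow> int \<Rightarrow> nat \<Rightarrow> int set" where
  "window x p N = {i \<in> {p..<p + int N}. x i}"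

text \<open>Squared form of the bound \<open>3 * sqrt N\<close>, which keeps the combinatorics in
  the natural numbers. Uniformity in \<open>p\<close> makes it shift invariant.\<close>

definition sparse :: "sigma2 \<Rightarrow> bool" where
  "sparse x \<longleftrightarrow> (\<forall>p N. (card (window x p N))\<^sup>2 \<le> 9 * N)"

lemma finite_window [simp]: "finite (window x p N)"
  unfolding window_def by (rule finite_subset[of _ "{p..<p + int N}"]) auto

lemma sparse_subset:
  assumes "sparse x" "window z p N \<subseteq> window x q N"
  shows "(card (window z p N))\<^sup>2 \<le> 9 * N"
proof -
  have "(card (window z p N))\<^sup>2 \<le> (card (window x q N))\<^sup>2"
    using assms(2) by (intro power_mono card_mono) auto
  then show ?thesis
    using assms(1) unfolding sparse_def by (meson le_trans)
qed

lemma window_shift_by: "window (shift_by n x) p N = (\<lambda>i. i - n) ` window x (p + n) N"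
proof (intro set_eqI iffI)
  fix i assume "i \<in> window (shift_by n x) p N"
  then show "i \<in> (\<lambda>i. i - n) ` window x (p + n) N"
    by (intro image_eqI[of _ _ "i + n"]) (auto simp: window_def shift_by_def)
qed (auto simp: window_def shift_by_def)

lemma sparse_shift_by:
  assumes "sparse x"
  shows "sparse (shift_by n x)"
  using assms unfolding sparse_def window_shift_by by (simp add: card_image inj_on_def)

text \<open>A window involves finitely many coordinates. Since \<open>bool\<close> is discrete, each
  of them is eventually constant along \<open>f\<close>, so some \<open>f n\<close> has exactly the
  same window as \<open>x\<close>.\<close>

lemma sparse_limit:
  fixes f :: "nat \<Rightarrow> sigma2"
  assumes "f \<longlonglongrightarrow> x" "\<And>n. sparse (f n)"
  shows "sparse x"
  unfolding sparse_def
proof (intro allI)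
  fix p N
  have "\<forall>\<^sub>F n in sequentially. f n i = x i" for i
  proof -
    have "(\<lambda>n. f n i) \<longlonglongrightarrow> x i"
      using assms(1) by (simp add: tendsto_sigma2)
    then show ?thesis
      by (simp add: tendsto_discrete)
  qed
  then have "\<forall>\<^sub>F n in sequentially. \<forall>i \<in> {p..<p + int N}. f n i = x i"
    by (intro eventually_ball_finite) auto
  then obtain n where "\<forall>i \<in> {p..<p + int N}. f n i = x i"
    using eventually_happens'[OF sequentially_bot] by blast
  then have "window x p N = window (f n) p N"
    by (auto simp: window_def)
  then show "(card (window x p N))\<^sup>2 \<le> 9 * N"
    using assms(2)[of n] by (simp add: sparse_def)
qed

section \<open>Concatenation of sparse words across a long gap\<close>

lemma pad_append: "pad (u @ v) i \<longleftrightarrow> pad u i \<or> pad v (i - int (length u))"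
  by (auto simp: pad_def nth_append nat_diff_distrib nat_less_iff)

lemma pad_append3:
  "pad (u @ O_word g @ v) i \<longleftrightarrow> pad u i \<or> pad v (i - int (length u + g))"
proof -
  have "\<not> pad (O_word g) j" for j
    by (auto simp: pad_def)
  then show ?thesis
    by (simp add: pad_append algebra_simps)
qed

lemma pad_range: "pad w i \<Longrightarrow> 0 \<le> i \<and> i < int (length w)"
  by (auto simp: pad_def)

lemma ones_eq_card: "length (filter id w) = card {i. pad w i}"
proof -
  have "{i. pad w i} = int ` {i. i < length w \<and> w ! i}"
  proof (intro set_eqI iffI)
    fix i assume "i \<in> {i. pad w i}"
    then show "i \<in> int ` {i. i < length w \<and> w ! i}"
      by (intro image_eqI[of _ _ "nat i"]) (auto simp: pad_def)
  qed (auto simp: pad_def)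
  then show ?thesis
    by (simp add: length_filter_conv_card card_image)
qed

lemma card_window_pad_le: "card (window (pad w) p N) \<le> length (filter id w)"
  unfolding ones_eq_card
proof (rule card_mono)
  show "finite {i. pad w i}"
    by (rule finite_subset[of _ "{0..<int (length w)}"]) (auto dest: pad_range)
qed (auto simp: window_def)

text \<open>The hypothesis on \<open>g\<close> says that a window of length \<open>g\<close> may
  already contain every one of both words. A window shorter than \<open>g\<close> cannot meet both
  words, so the bound for a single word applies.\<close>

lemma sparse_append:
  assumes u: "sparse (pad u)" and v: "sparse (pad v)"
    and g: "(length (filter id u) + length (filter id v))\<^sup>2 \<le> 9 * g"
  shows "sparse (pad (u @ O_word g @ v))"
  unfolding sparse_def
proof (intro allI)
  fix p N
  let ?w = "u @ O_word g @ v"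
  show "(card (window (pad ?w) p N))\<^sup>2 \<le> 9 * N"
  proof (cases "g \<le> N")
    case True
    have "card (window (pad ?w) p N) \<le> length (filter id u) + length (filter id v)"
      using card_window_pad_le[of ?w p N] by simp
    then have "(card (window (pad ?w) p N))\<^sup>2 \<le> (length (filter id u) + length (filter id v))\<^sup>2"
      by (rule power_mono) simp
    with g True show ?thesis
      by linarith
  next
    case False
    show ?thesis
    \<comment> \<open>With \<open>N < g\<close>, a window starting inside or before \<open>u\<close>
      ends before \<open>v\<close> begins. A window starting later misses \<open>u\<close> and sees
      only a translate of \<open>v\<close>.\<close>
    proof (cases "p < int (length u)")
      case True
      have "window (pad ?w) p N \<subseteq> window (pad u) p N"
        using True False unfolding window_def pad_append3 by (auto dest: pad_range)
      then show ?thesis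
        by (rule sparse_subset[OF u])
    next
      case p: False
      let ?k = "int (length u + g)"
      have "window (pad ?w) p N \<subseteq> window (shift_by (- ?k) (pad v)) p N"
        using p unfolding window_def pad_append3 shift_by_def diff_conv_add_uminus by (auto dest: pad_range)
      then show ?thesis
        by (rule sparse_subset[OF sparse_shift_by[OF v]])
    qed
  qed
qed

lemma sparse_take:
  assumes "sparse (pad w)"
  shows "sparse (pad (take n w))"
  unfolding sparse_def
  by (intro allI sparse_subset[OF assms]) (auto simp: window_def pad_def)

section \<open>The bound for the recursively defined words\<close>

lemma Q_word_properties:
  assumes "\<And>m. m \<le> Suc n \<Longrightarrow> sparse (pad (A_word m))"
  shows "sparse (pad (Q_word (Suc n))) \<and> length (filter id (Q_word (Suc n))) \<le> 2 * Suc n"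
proof -
  obtain a b where ab: "(a, b) = prod_decode n"
    by (metis surj_pair)
  let ?P = "P_word (Suc a)"
  have Q: "Q_word (Suc n) = ?P @ O_word ((Suc a)\<^sup>2 - 1 + Suc b) @ ?P"
    using ab[symmetric] by (simp add: Q_word.simps)
  have a: "a \<le> n"
    using fst_prod_decode_le[OF ab] .
  have ones: "length (filter id ?P) \<le> Suc a"
    by (rule order.trans[OF length_filter_le]) (simp add: P_word.simps)
  have "(length (filter id ?P) + length (filter id ?P))\<^sup>2 \<le> (2 * Suc a)\<^sup>2"
    using ones by (intro power_mono) auto
  \<comment> \<open>The gap is at least \<open>(Suc a)\<^sup>2\<close>, because \<open>Suc b\<close>
    makes up for the subtracted 1, so there is room for the at most \<open>2 * Suc a\<close> ones of
    the two copies.\<close>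
  also have "\<dots> \<le> 9 * ((Suc a)\<^sup>2 - 1 + Suc b)"
    by (simp add: power2_eq_square)
  finally have "sparse (pad (Q_word (Suc n)))"
    unfolding Q using a assms[of "Suc a"] by (intro sparse_append) (auto simp: P_word.simps intro: sparse_take)
  then show ?thesis
    using ones a unfolding Q by simp
qed

text \<open>Strong induction is used because \<open>Q_word (Suc m)\<close> is built from a prefix of
  an earlier \<open>A_word\<close>, not necessarily the last one.\<close>

lemma sparse_A_word: "sparse (pad (A_word n))"
proof (induction n rule: less_induct)
  case (less n)
  consider "n = 0" | "n = 1" | m where "n = Suc (Suc m)"
    by (metis One_nat_def old.nat.exhaust)
  then show ?case
  proof cases
    case 1
    then show ?thesis
      by (simp add: sparse_def window_def pad_def A_word.simps)
  next
    case 2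
    have "(card (window (pad [True]) p N))\<^sup>2 \<le> 9 * N" for p N
    proof (cases "N = 0")
      case False
      have "(card (window (pad [True]) p N))\<^sup>2 \<le> 1\<^sup>2"
        using card_window_pad_le[of "[True]" p N] by (intro power_mono) auto
      with False show ?thesis
        by simp
    qed (simp add: window_def)
    with 2 show ?thesis
      by (simp add: sparse_def A_word.simps)
  next
    case (3 m)
    let ?A = "A_word (Suc m)" and ?Q = "Q_word (Suc m)"
    have Q: "sparse (pad ?Q)" "length (filter id ?Q) \<le> 2 * Suc m"
      using Q_word_properties[of m] less.IH 3 by auto
    \<comment> \<open>The origin of the constant 9: together the two words have at most
      \<open>3 * length ?A\<close> ones, while the gap is
      \<open>(length ?A)\<^sup>2\<close>.\<close>
    have "length (filter id ?A) + length (filter id ?Q) \<le> length ?A + 2 * length ?A"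
      by (intro add_mono length_filter_le order.trans[OF Q(2)] mult_le_mono2 length_A)
    then have "length (filter id ?A) + length (filter id ?Q) \<le> 3 * length ?A"
      by simp
    then have "(length (filter id ?A) + length (filter id ?Q))\<^sup>2 \<le> (3 * length ?A)\<^sup>2"
      by (rule power_mono) simp
    then show ?thesis
      unfolding 3 A_word.simps using Q less.IH[of "Suc m"] 3
      by (intro sparse_append) (auto simp: power_mult_distrib)
  qed
qed

text \<open>Sparsity survives shifts and limits: it passes from the words to \<open>y_seq\<close>,
  then to limits of shifts of \<open>y_seq\<close>.\<close>

lemma sparse_Y:
  assumes "z \<in> Y"
  shows "sparse z"
proof -
  have "sparse y_seq"
    using y_limit sparse_A_word by (rule sparse_limit)
  moreover obtain k where "(\<lambda>n. (shift_map ^^ k n) y_seq) \<longlonglongrightarrow> z"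
    using assms by (auto simp: Y_def omega_limit_def)
  ultimately show ?thesis
    by (intro sparse_limit[of "\<lambda>n. (shift_map ^^ k n) y_seq" z])
      (auto simp: shift_map_funpow intro: sparse_shift_by)
qed

section \<open>Continuity of the flow\<close>

lemma continuous_shift_by: "continuous_on UNIV (shift_by n)"
  unfolding shift_by_def
  by (intro continuous_on_coordinatewise_then_product continuous_on_product_coordinates)

lemma continuous_map_susp_class: "continuous_map (top_of_set susp_dom) suspension susp_class"
  unfolding suspension_def
  by (rule quotient_imp_continuous_map[OF quotient_map_quotient_topology])

text \<open>The floor in \<open>move\<close> jumps. On a closed strip where the number
  \<open>n\<close> of shifts is frozen, the formula is continuous and still lands in
  \<open>susp_dom\<close>, including at the upper end.\<close>

lemma continuous_map_piece:
  "continuous_map (subtopology (top_of_set susp_dom) {p. n \<le> snd p + t \<and> snd p + t \<le> n + 1})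
     suspension (\<lambda>p. susp_class (shift_by n (fst p), snd p + t - of_int n))"
proof -
  have "continuous_on UNIV (\<lambda>p :: sigma2 \<times> real. shift_by n (fst p))"
    by (rule continuous_on_compose2[OF continuous_shift_by continuous_on_fst[OF continuous_on_id]]) simp
  then have c: "continuous_on S (\<lambda>p :: sigma2 \<times> real. (shift_by n (fst p), snd p + t - of_int n))" for S
    by (rule continuous_on_subset[OF continuous_on_Pair])
      (auto intro!: continuous_on_diff continuous_on_add continuous_on_snd continuous_on_id
        continuous_on_const)
  have "continuous_map (subtopology (top_of_set susp_dom) {p. n \<le> snd p + t \<and> snd p + t \<le> n + 1})
     (top_of_set susp_dom) (\<lambda>p. (shift_by n (fst p), snd p + t - of_int n))"
    unfolding subtopology_subtopology using c
    by (auto simp: susp_dom_def shift_by_in_Y_star)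
  from continuous_map_compose[OF this continuous_map_susp_class] show ?thesis
    by (simp add: comp_def)
qed

text \<open>At the upper end \<open>u + t = n + 1\<close> the floor has already jumped, but the
  gluing identifies the two representatives. Hence the formulas of neighbouring strips agree where
  they meet.\<close>

lemma susp_class_move:
  assumes "z \<in> Y_star" "of_int n \<le> u + t" "u + t \<le> of_int n + 1"
  shows "susp_class (move t (z, u)) = susp_class (shift_by n z, u + t - of_int n)"
proof (cases "u + t = of_int n + 1")
  case True
  then have "move t (z, u) = (shift_map (shift_by n z), 0)"
    by (simp add: move_def shift_map_def frac_def add.commute[of n])
  then show ?thesis
    using True susp_class_glue[OF shift_by_in_Y_star[OF assms(1)], of n] by simp
next
  case False
  then have "\<lfloor>u + t\<rfloor> = n"
    using assms by linarith
  then show ?thesis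
    by (simp add: move_def frac_def)
qed

lemma continuous_map_psi1: "continuous_map suspension suspension (psi1 t)"
proof -
  define n where "n = \<lfloor>t\<rfloor>"
  define F where "F m p = susp_class (shift_by m (fst p), snd p + t - of_int m)"
    for m :: int and p :: "sigma2 \<times> real"
  let ?X = "top_of_set susp_dom"
  have n: "of_int n \<le> t" "t < of_int n + 1"
    by (simp_all add: n_def)
  have piece: "continuous_map (subtopology ?X S) suspension (F m)"
    if "susp_dom \<inter> S \<subseteq> {p. m \<le> snd p + t \<and> snd p + t \<le> m + 1}" for S and m :: int
  proof -
    have "subtopology ?X S = subtopology (subtopology ?X {p. m \<le> snd p + t \<and> snd p + t \<le> m + 1}) S"
      using that unfolding subtopology_subtopology by (intro arg_cong2[of _ _ _ _ subtopology]) auto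
    then show ?thesis
      unfolding F_def using continuous_map_from_subtopology[OF continuous_map_piece[of m t]] by simp
  qed
  have agree: "F n p = F (n + 1) p" if "p \<in> susp_dom" "snd p + t = of_int n + 1" for p
  proof -
    have "fst p \<in> Y_star"
      using that(1) by (auto simp: susp_dom_def)
    with that(2) show ?thesis
      unfolding F_def using susp_class_move[of "fst p" n "snd p" t] susp_class_move[of "fst p" "n + 1" "snd p" t]
      by simp
  qed
  \<comment> \<open>As \<open>0 \<le> u \<le> 1\<close>, the value \<open>u + t\<close> stays
    between \<open>n\<close> and \<open>n + 2\<close>, so two closed strips cover the domain and can
    be pasted. Continuity then descends through the quotient map.\<close>
  have "continuous_map ?X suspension
      (\<lambda>p. if snd p + t \<le> of_int n + 1 then F n p else F (n + 1) p)"
  proof (rule continuous_map_cases_le)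
    show "continuous_map ?X euclideanreal (\<lambda>p. snd p + t)"
      by (auto intro!: continuous_intros)
    show "continuous_map (subtopology ?X {p \<in> topspace ?X. snd p + t \<le> of_int n + 1}) suspension (F n)"
      using n by (intro piece) (auto simp: susp_dom_def)
    show "continuous_map (subtopology ?X {p \<in> topspace ?X. of_int n + 1 \<le> snd p + t}) suspension (F (n + 1))"
      using n by (intro piece) (auto simp: susp_dom_def)
  qed (use agree in auto)
  moreover have "(psi1 t \<circ> susp_class) p = (if snd p + t \<le> of_int n + 1 then F n p else F (n + 1) p)"
    if "p \<in> topspace ?X" for p
  proof -
    have "fst p \<in> Y_star" "0 \<le> snd p" "snd p \<le> 1" "p \<in> susp_dom"
      using that by (auto simp: susp_dom_def)
    then show ?thesis
      unfolding comp_def F_def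
      using n susp_class_move[of "fst p" n "snd p" t] susp_class_move[of "fst p" "n + 1" "snd p" t]
      by (simp add: psi1_susp_class)
  qed
  ultimately have "continuous_map ?X suspension (psi1 t \<circ> susp_class)"
    by (rule continuous_map_eq[OF _ sym])
  then show ?thesis
    unfolding suspension_def
    by (simp add: continuous_compose_quotient_map_eq[OF quotient_map_quotient_topology])
qed

lemma psi1_inverse:
  assumes "C \<in> topspace suspension"
  shows "psi1 (- t) (psi1 t C) = C"
proof -
  have x: "Some C \<in> topspace Y1"
    using assms by (simp add: topspace_Y1 topspace_suspension)
  have "Psi1 (- t) (Psi1 t (Some C)) = Some C"
    using Psi1_add[OF x, of "- t" t] Psi1_0[OF x] by simp
  then show ?thesis
    by (simp add: Psi1_def)
qed

text \<open>Supplies the Borel measurability that \<open>flow_invariant\<close> demands of the point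
  mass.\<close>

lemma continuous_map_Psi1: "continuous_map Y1 Y1 (Psi1 t)"
  unfolding continuous_map
proof (intro conjI allI impI)
  show "Psi1 t ` topspace Y1 \<subseteq> topspace Y1"
    using Psi1_in_Y1 by blast
next
  fix U assume "openin Y1 U"
  then consider W where "openin suspension W" "U = Some ` W"
    | C where "compactin suspension C" "closedin suspension C"
        "U = insert None (Some ` (topspace suspension - C))"
    unfolding Y1_def openin_Alexandroff_compactification by blast
  then show "openin Y1 {x \<in> topspace Y1. Psi1 t x \<in> U}"
  proof cases
    case 1
    have "{x \<in> topspace Y1. Psi1 t x \<in> U} = Some ` {x \<in> topspace suspension. psi1 t x \<in> W}"
      using 1(2) by (auto simp: Y1_def Psi1_def)
    then show ?thesis
      unfolding Y1_def openin_Alexandroff_compactification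
      using openin_continuous_map_preimage[OF continuous_map_psi1 1(1)] by blast
  next
    case 2
    let ?D = "{x \<in> topspace suspension. psi1 t x \<in> C}"
    have C: "C \<subseteq> topspace suspension"
      using 2(2) closedin_subset by blast
    have top: "psi1 s x \<in> topspace suspension" if "x \<in> topspace suspension" for s x
      using continuous_map_psi1 that by (auto simp: continuous_map_def)
    \<comment> \<open>Neighbourhoods of infinity are complements of closed compact sets. Writing the
      preimage of \<open>C\<close> as an image under the inverse map shows that it is compact
      again.\<close>
    have "?D = psi1 (- t) ` C"
    proof (intro equalityI subsetI)
      fix x assume "x \<in> ?D"
      then show "x \<in> psi1 (- t) ` C"
        by (intro image_eqI[of _ _ "psi1 t x"]) (auto simp: psi1_inverse)
    next
      fix x assume "x \<in> psi1 (- t) ` C"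
      then show "x \<in> ?D"
        using C top psi1_inverse[of _ "- t"] by auto
    qed
    then have "compactin suspension ?D"
      using image_compactin[OF 2(1) continuous_map_psi1] by simp
    moreover have "closedin suspension ?D"
      by (rule closedin_continuous_map_preimage[OF continuous_map_psi1 2(2)])
    moreover have "{x \<in> topspace Y1. Psi1 t x \<in> U} = insert None (Some ` (topspace suspension - ?D))"
      using 2(3) top by (auto simp: Y1_def Psi1_def)
    ultimately show ?thesis
      unfolding Y1_def openin_Alexandroff_compactification by blast
  qed
qed

section \<open>Invariant measures\<close>

text \<open>The heights 0 and 1 are left out so that each class involved has a single
  representative, which makes membership readable from coordinates and the set open.\<close>

definition cylinder :: "Y1_point set" where
  "cylinder = Some ` susp_class ` {(z, u). z \<in> Y_star \<and> z 0 \<and> 0 < u \<and> u < 1}"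

lemma susp_class_interior_eq:
  assumes "susp_class (z, u) = susp_class p" "0 < u" "u < 1" "z \<in> Y_star" "p \<in> susp_dom"
  shows "p = (z, u)"
proof -
  have "((z, u), p) \<in> susp_rel"
    using assms eq_equiv_class[OF _ equiv_susp_rel] unfolding susp_class_def by blast
  \<comment> \<open>\<open>move 0\<close> is constant on classes and normalizes heights to the
    interval from 0 inclusive to 1 exclusive. It fixes \<open>(z, u)\<close>, whereas a point of
    height 1 would be sent to height 0.\<close>
  then have "move 0 (z, u) = move 0 p"
    by (rule move_eq_if_susp_rel)
  moreover have "\<lfloor>u\<rfloor> = 0"
    using assms by linarith
  moreover obtain z' u' where p: "p = (z', u')" "0 \<le> u'" "u' \<le> 1"
    using assms(5) by (auto simp: susp_dom_def)
  moreover have "u' \<noteq> 1"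
  proof
    assume "u' = 1"
    then show False
      using calculation assms(2) by (simp add: move_def frac_def)
  qed
  moreover from this have "\<lfloor>u'\<rfloor> = 0"
    using p by linarith
  ultimately show ?thesis
    by (simp add: move_def frac_def)
qed

lemma cylinder_iff:
  assumes "(z, u) \<in> susp_dom"
  shows "Some (susp_class (z, u)) \<in> cylinder \<longleftrightarrow> z 0 \<and> 0 < u \<and> u < 1"
  using assms unfolding cylinder_def susp_dom_def
  by (auto dest!: susp_class_interior_eq[OF sym] simp: susp_dom_def)

lemma openin_cylinder: "openin Y1 cylinder"
proof -
  let ?S = "{(z, u). z \<in> Y_star \<and> z 0 \<and> 0 < u \<and> u < 1} :: (sigma2 \<times> real) set"
  have "open ((\<lambda>z :: sigma2. z 0) -` {True})"
    by (intro open_vimage Topological_Spaces.open_discrete continuous_on_product_coordinates)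
  then have "open (((\<lambda>z :: sigma2. z 0) -` {True}) \<times> {0<..<1 :: real})"
    by (intro open_Times) auto
  moreover have "?S = susp_dom \<inter> ((\<lambda>z. z 0) -` {True}) \<times> {0<..<1}"
    by (auto simp: susp_dom_def)
  ultimately have "openin (top_of_set susp_dom) ?S"
    by (auto simp: openin_open)
  \<comment> \<open>\<open>?S\<close> is saturated, so its openness transfers to the
    quotient.\<close>
  moreover have "{p \<in> susp_dom. susp_class p \<in> susp_class ` ?S} = ?S"
    by (auto simp: susp_dom_def dest!: susp_class_interior_eq[OF sym])
  moreover have "susp_class ` ?S \<subseteq> susp_class ` susp_dom"
    by (intro image_mono) (auto simp: susp_dom_def)
  ultimately have "openin suspension (susp_class ` ?S)"
    by (simp add: suspension_def openin_quotient_topology)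
  then show ?thesis
    unfolding cylinder_def Y1_def openin_Alexandroff_compactification by blast
qed

text \<open>Integer times keep the height and only shift the base point, so distinct visits inject
  into the ones of \<open>z\<close> in a window of length \<open>N\<close>.\<close>

lemma visits_cylinder_le:
  assumes "x \<in> topspace Y1"
  shows "(card {k. k < N \<and> Psi1 (real k) x \<in> cylinder})\<^sup>2 \<le> 9 * N"
  using assms
proof (cases rule: Y1_cases)
  case 1
  have "y_inf \<notin> cylinder"
    by (auto simp: y_inf_def cylinder_def)
  with 1 show ?thesis
    by (simp add: Psi1_y_inf)
next
  case (2 z u)
  \<comment> \<open>The offset \<open>\<lfloor>u\<rfloor>\<close> is 0 except for a representative
    of height 1, where it is 1.\<close>
  have "z (\<lfloor>u\<rfloor> + int k)" if "Psi1 (real k) x \<in> cylinder" for k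
  proof -
    have "move (real k) (z, u) = (shift_by (\<lfloor>u\<rfloor> + int k) z, frac (u + real k))"
      by (simp add: move_def)
    then show ?thesis
      using that 2 move_in_susp_dom[OF 2(1), of "real k"]
      by (simp add: Psi1_susp_class cylinder_iff) (simp add: shift_by_def)
  qed
  then have "(\<lambda>k. \<lfloor>u\<rfloor> + int k) ` {k. k < N \<and> Psi1 (real k) x \<in> cylinder} \<subseteq> window z \<lfloor>u\<rfloor> N"
    by (auto simp: window_def)
  then have "card {k. k < N \<and> Psi1 (real k) x \<in> cylinder} \<le> card (window z \<lfloor>u\<rfloor> N)"
    by (intro card_inj_on_le) (auto simp: inj_on_def)
  then have "(card {k. k < N \<and> Psi1 (real k) x \<in> cylinder})\<^sup>2 \<le> (card (window z \<lfloor>u\<rfloor> N))\<^sup>2"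
    by (rule power_mono) simp
  moreover have "sparse z"
    using 2 by (intro sparse_Y) (auto simp: susp_dom_def Y_star_def)
  ultimately show ?thesis
    unfolding sparse_def by (meson le_trans)
qed

text \<open>By invariance the expected number of visits at times below \<open>N\<close> is
  \<open>N\<close> times the measure of \<open>cylinder\<close>, while every orbit makes at most
  \<open>3 * sqrt N\<close> such visits. Dividing by \<open>N\<close> and letting \<open>N\<close>
  grow gives zero.\<close>

lemma cylinder_null:
  assumes X: "borel_prob_on Y1 \<mu>" and inv: "flow_invariant Psi1 \<mu>"
  shows "emeasure \<mu> cylinder = 0"
proof -
  interpret prob_space \<mu>
    using X by (simp add: borel_prob_on_def)
  have sp: "space \<mu> = topspace Y1"
    using X by (simp add: borel_prob_on_def)
  have C: "cylinder \<in> sets \<mu>"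
    using X openin_cylinder by (auto simp: borel_prob_on_def intro: sigma_sets.Basic)
  define V where "V k = Psi1 (real k) -` cylinder \<inter> space \<mu>" for k
  have V: "V k \<in> sets \<mu>" "measure \<mu> (V k) = measure \<mu> cylinder" for k
    using inv C unfolding flow_invariant_def V_def by (auto intro: measurable_sets simp: measure_def)
  have visits: "(\<Sum>k<N. indicat_real (V k) x) \<le> 3 * sqrt (real N)" if "x \<in> space \<mu>" for N x
  proof -
    have "(\<Sum>k<N. indicat_real (V k) x) = real (card {k. k < N \<and> Psi1 (real k) x \<in> cylinder})"
      using that by (simp add: V_def indicator_def sum.If_cases Int_def)
    moreover have "(real (card {k. k < N \<and> Psi1 (real k) x \<in> cylinder}))\<^sup>2 \<le> 9 * real N"
      using visits_cylinder_le[of x N] that sp by (simp flip: of_nat_power add: of_nat_le_iff)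
    ultimately have "(\<Sum>k<N. indicat_real (V k) x) \<le> sqrt (9 * real N)"
      by (simp add: real_le_rsqrt)
    also have "\<dots> = 3 * sqrt (real N)"
      by (simp add: real_sqrt_mult real_sqrt_unique)
    finally show ?thesis .
  qed
  have bound: "real N * prob cylinder \<le> 3 * sqrt (real N)" for N
  proof -
    have "real N * prob cylinder = (\<Sum>k<N. prob (V k))"
      by (simp add: V)
    also have "\<dots> = (\<integral>x. (\<Sum>k<N. indicat_real (V k) x) \<partial>\<mu>)"
      using V by (subst Bochner_Integration.integral_sum) (auto simp: emeasure_eq_measure)
    also have "\<dots> \<le> (\<integral>x. 3 * sqrt (real N) \<partial>\<mu>)"
      using V visits by (intro integral_mono) (auto simp: emeasure_eq_measure)
    finally show ?thesis
      by (simp add: prob_space)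
  qed
  have "prob cylinder \<le> 3 / sqrt (real N)" if "N > 0" for N
  proof -
    have "sqrt (real N) * (sqrt (real N) * prob cylinder) \<le> sqrt (real N) * 3"
      using bound[of N] by (simp add: mult.assoc[symmetric] mult.commute)
    then show ?thesis
      using that by (simp add: field_simps)
  qed
  moreover have "(\<lambda>N. 3 / sqrt (real N)) \<longlonglongrightarrow> 0"
    by real_asymp
  ultimately have "prob cylinder \<le> 0"
    \<comment> \<open>The comparison starts at \<open>N = 1\<close>, since the quotient at
      \<open>N = 0\<close> is 0 by convention.\<close>
    by (intro LIMSEQ_le_const) (auto intro!: exI[of _ 1])
  then show ?thesis
    by (simp add: emeasure_eq_measure measure_le_0_iff)
qed

section \<open>Concentration of invariant measures at infinity\<close>

lemma topspace_Y1_cover: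
  "topspace Y1 - {y_inf} \<subseteq> (\<Union>m :: int. Psi1 (of_int m / 2) -` cylinder \<inter> topspace Y1)"
proof
  fix x assume "x \<in> topspace Y1 - {y_inf}"
  then obtain z u where x: "x \<in> topspace Y1" "(z, u) \<in> susp_dom" "x = Some (susp_class (z, u))"
    using Y1_cases by blast
  then obtain i where i: "z i"
    by (auto simp: susp_dom_def Y_star_def zero_seq_def fun_eq_iff)
  \<comment> \<open>The even part brings the one at position \<open>i\<close> to the origin. The
    extra half unit lifts points of integer height, which integer times would leave on the excluded
    boundary, to height \<open>1 / 2\<close>.\<close>
  define m where "m = 2 * (i - \<lfloor>u\<rfloor>) + (if frac u = 0 then 1 else 0)"
  have "u + of_int m / 2 = frac u + (if frac u = 0 then 1 / 2 else 0) + of_int i"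
    by (simp add: m_def frac_def field_simps)
  then have "of_int i < u + of_int m / 2" "u + of_int m / 2 < of_int i + 1"
    using frac_ge_0[of u] frac_lt_1[of u] by (smt (verit) field_sum_of_halves)+
  moreover from this have "\<lfloor>u + of_int m / 2\<rfloor> = i"
    by (simp add: floor_eq_iff)
  ultimately have "\<lfloor>u + of_int m / 2\<rfloor> = i" "0 < frac (u + of_int m / 2)"
    by (simp_all add: frac_def)
  then have "Psi1 (of_int m / 2) x \<in> cylinder"
    using x i move_in_susp_dom[OF x(2), of "of_int m / 2"]
    by (simp add: Psi1_susp_class move_def cylinder_iff frac_lt_1 shift_by_def)
  with x show "x \<in> (\<Union>m :: int. Psi1 (of_int m / 2) -` cylinder \<inter> topspace Y1)"
    by blast
qed

lemma y_inf_in_sets: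
  assumes "borel_prob_on Y1 \<mu>"
  shows "{y_inf} \<in> sets \<mu>"
proof -
  have "openin Y1 (Some ` topspace suspension)"
    unfolding Y1_def openin_Alexandroff_compactification by blast
  then have "space \<mu> - Some ` topspace suspension \<in> sets \<mu>"
    using assms by (intro sets.compl_sets) (auto simp: borel_prob_on_def intro: sigma_sets.Basic)
  moreover have "space \<mu> - Some ` topspace suspension = {y_inf}"
    using assms by (auto simp: borel_prob_on_def topspace_Y1 topspace_suspension y_inf_def)
  ultimately show ?thesis
    by simp
qed

text \<open>Restricting to half-integer times makes the cover countable, and each preimage is as
  null as \<open>cylinder\<close> itself.\<close>

lemma emeasure_y_inf:
  assumes X: "borel_prob_on Y1 \<mu>" and inv: "flow_invariant Psi1 \<mu>"
  shows "emeasure \<mu> {y_inf} = 1"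
proof -
  interpret prob_space \<mu>
    using X by (simp add: borel_prob_on_def)
  have sp: "space \<mu> = topspace Y1"
    using X by (simp add: borel_prob_on_def)
  have C: "cylinder \<in> sets \<mu>"
    using X openin_cylinder by (auto simp: borel_prob_on_def intro: sigma_sets.Basic)
  have null: "Psi1 t -` cylinder \<inter> topspace Y1 \<in> null_sets \<mu>" for t
    using inv C cylinder_null[OF X inv] unfolding flow_invariant_def sp[symmetric]
    by (auto intro: measurable_sets simp: null_sets_def)
  have "(\<Union>m :: int. Psi1 (of_int m / 2) -` cylinder \<inter> topspace Y1) \<in> null_sets \<mu>"
    using null by (intro null_sets_UN')  auto
  then have "space \<mu> - {y_inf} \<in> null_sets \<mu>"
    unfolding sp
    by (rule null_sets_subset[OF _ _ topspace_Y1_cover])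
      (use y_inf_in_sets[OF X] in \<open>simp flip: sp add: sets.compl_sets\<close>)
  then have "emeasure \<mu> (space \<mu> - (space \<mu> - {y_inf})) = emeasure \<mu> (space \<mu>)"
    by (intro emeasure_Diff_null_set) auto
  moreover have "space \<mu> - (space \<mu> - {y_inf}) = {y_inf}"
    by (auto simp: sp topspace_Y1)
  ultimately show ?thesis
    by (simp add: emeasure_space_1)
qed

section \<open>Existence and uniqueness: the Dirac measure at infinity\<close>

definition point_mass :: "Y1_point measure" where
  "point_mass = return (sigma (topspace Y1) {U. openin Y1 U}) y_inf"

lemma point_mass_space: "space point_mass = topspace Y1"
  and point_mass_sets: "sets point_mass = sigma_sets (topspace Y1) {U. openin Y1 U}"
proof -
  have "{U. openin Y1 U} \<subseteq> Pow (topspace Y1)"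
    by (auto dest: openin_subset)
  then show "space point_mass = topspace Y1"
    "sets point_mass = sigma_sets (topspace Y1) {U. openin Y1 U}"
    by (simp_all add: point_mass_def)
qed

lemma emeasure_point_mass: "B \<in> sets point_mass \<Longrightarrow> emeasure point_mass B = indicator B y_inf"
  by (simp add: point_mass_def)

text \<open>Since \<open>y_inf\<close> is fixed, it lies in a set exactly when it lies in the
  preimage, which gives invariance. Ergodicity holds because the measure takes only the values 0 and
  1.\<close>

lemma invariant_ergodic_point_mass: "invariant_ergodic_measure Y1 Psi1 point_mass"
  unfolding invariant_ergodic_measure_def
proof (intro conjI)
  have "prob_space point_mass"
    unfolding point_mass_def by (rule prob_space_return) (simp add: space_measure_of_conv topspace_Y1)
  then show "borel_prob_on Y1 point_mass"
    by (simp add: borel_prob_on_def point_mass_space point_mass_sets)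
  have meas: "Psi1 t \<in> measurable point_mass point_mass" for t
  proof (rule measurable_sigma_sets[OF point_mass_sets])
    fix U assume "U \<in> {U. openin Y1 U}"
    then have "openin Y1 {x \<in> topspace Y1. Psi1 t x \<in> U}"
      using openin_continuous_map_preimage[OF continuous_map_Psi1] by simp
    moreover have "Psi1 t -` U \<inter> space point_mass = {x \<in> topspace Y1. Psi1 t x \<in> U}"
      by (auto simp: point_mass_space)
    ultimately show "Psi1 t -` U \<inter> space point_mass \<in> sets point_mass"
      by (auto simp: point_mass_sets intro: sigma_sets.Basic)
  qed (auto simp: point_mass_space Psi1_in_Y1 dest: openin_subset)
  have "emeasure point_mass (Psi1 t -` B \<inter> space point_mass) = emeasure point_mass B"
    if "B \<in> sets point_mass" for t B
    using that measurable_sets[OF meas that]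
    by (simp add: emeasure_point_mass indicator_def Psi1_y_inf point_mass_space topspace_Y1)
  with meas show "flow_invariant Psi1 point_mass"
    by (simp add: flow_invariant_def)
  show "flow_ergodic Psi1 point_mass"
    by (auto simp: flow_ergodic_def emeasure_point_mass indicator_def)
qed

lemma eq_point_mass:
  assumes "borel_prob_on Y1 \<mu>" "flow_invariant Psi1 \<mu>"
  shows "\<mu> = point_mass"
proof (rule measure_eqI)
  interpret prob_space \<mu>
    using assms by (simp add: borel_prob_on_def)
  show sets: "sets \<mu> = sets point_mass"
    using assms by (simp add: borel_prob_on_def point_mass_sets)
  have y: "{y_inf} \<in> sets \<mu>" "prob {y_inf} = 1"
    using y_inf_in_sets emeasure_y_inf assms by (auto simp: measure_def)
  fix B assume B: "B \<in> sets \<mu>"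
  have "prob B = indicator B y_inf"
  proof (cases "y_inf \<in> B")
    case True
    then have "prob {y_inf} \<le> prob B"
      using B by (intro finite_measure_mono) auto
    with True y show ?thesis
      by (simp add: antisym)
  next
    case False
    \<comment> \<open>The point already carries mass 1, so additivity leaves nothing for a set
      disjoint from it.\<close>
    then have "prob (B \<union> {y_inf}) = prob B + prob {y_inf}"
      using B y by (intro finite_measure_Union) auto
    with False y show ?thesis
      using prob_le_1[of "B \<union> {y_inf}"] by (simp add: antisym)
  qed
  then show "emeasure \<mu> B = emeasure point_mass B"
    using B sets by (simp add: emeasure_point_mass emeasure_eq_measure indicator_def)
qed

theorem theoremD:
  shows "(\<exists>!\<mu>. invariant_ergodic_measure Y1 Psi1 \<mu>) \<and>
    (\<forall>\<mu>. invariant_ergodic_measure Y1 Psi1 \<mu> \<longrightarrow> emeasure \<mu> {y_inf} = 1)"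
  using invariant_ergodic_point_mass eq_point_mass emeasure_y_inf
  unfolding invariant_ergodic_measure_def by blast

end
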